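(* Let $\Sigma$ be the system $x(t+1)=Ax(t)+Bu(t)+Ed(t)$, $y(t)=Cx(t)$, with $C=[\,C_1\mid C_2\,]$, $C_2\in\mathbb{R}^{p\times p}$ nonsingular, and let $U_p,D_p,X_p,Y_p,Y_f,X_{p,1},X_{f,1}$ be the data matrices of historical data generated by $\Sigma$. Assume that $\begin{bmatrix} U_p^\top & D_p^\top & X_p^\top\end{bmatrix}^\top$ has full row rank $m+q+n$. Then the kernel inclusion $$\ker(X_{f,1})\supseteq\ker\left(\begin{bmatrix}U_p\\ Y_p\\ Y_f\\ X_{p,1}\end{bmatrix}\right)$$ holds if and only if there exist real matrices $A_{UIO}\in\mathbb{R}^{(n-p)\times(n-p)}$, $B^u_{UIO}\in\mathbb{R}^{(n-p)\times m}$, $B^y_{UIO},D_{UIO}\in\mathbb{R}^{(n-p)\times p}$ such that $$\begin{aligned} A_{UIO}&=(I-D_{UIO}C_1)(A_{11}-A_{12}C_2^{-1}C_1)-D_{UIO}C_2(A_{21}-A_{22}C_2^{-1}C_1),\\ B_{UIO}^u&=(I-D_{UIO}C_1)B_1-D_{UIO}C_2B_2,\\ B_{UIO}^y&=A_{UIO}D_{UIO}+(I-D_{UIO}C_1)A_{12}C_2^{-1}-D_{UIO}C_2A_{22}C_2^{-1},\\ 0&=(I-D_{UIO}C_1)E_1-D_{UIO}C_2E_2. \end{aligned}$$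
   Context: System: $x(t)\in\mathbb{R}^n$ is the state, $u(t)\in\mathbb{R}^m$ the known input, $d(t)\in\mathbb{R}^q$ the unknown input, $y(t)\in\mathbb{R}^p$ the output; $A,B,E,C$ are real matrices of compatible sizes, with $\operatorname{rank}(E)=q$, $\operatorname{rank}(C)=p$, and $C=[\,C_1\mid C_2\,]$ with $C_1\in\mathbb{R}^{p\times(n-p)}$ and $C_2\in\mathbb{R}^{p\times p}$ nonsingular. Conformably, $A=\begin{bmatrix} A_{11} & A_{12} \\ A_{21} & A_{22} \end{bmatrix}$, $B=\begin{bmatrix} B_1 \\ B_2 \end{bmatrix}$, $E=\begin{bmatrix} E_1 \\ E_2 \end{bmatrix}$ with $A_{11}\in\mathbb{R}^{(n-p)\times(n-p)}$, $A_{22}\in\mathbb{R}^{p\times p}$, and $B_1,E_1$ having $n-p$ rows and $B_2,E_2$ having $p$ rows. Data: the historical sequences are $u_d=\{u_d(t)\}_{t=0}^{T-2}$, $d_d=\{d_d(t)\}_{t=0}^{T-2}$, $x_d=\{x_d(t)\}_{t=0}^{T-1}$, $y_d=\{y_d(t)\}_{t=0}^{T-1}$, satisfying $x_d(t+1)=Ax_d(t)+Bu_d(t)+Ed_d(t)$ for $0\le t\le T-2$ and $y_d(t)=Cx_d(t)$ for $0\le t\le T-1$. Write $x_d(t)=[x_{d,1}(t)^\top\ x_{d,2}(t)^\top]^\top$ with $x_{d,1}(t)\in\mathbb{R}^{n-p}$, $x_{d,2}(t)\in\mathbb{R}^{p}$. The data matrices (each with $T-1$ columns) are $U_p=[u_d(0)\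 \dots\ u_d(T-2)]$, $D_p=[d_d(0)\ \dots\ d_d(T-2)]$, $X_p=[x_d(0)\ \dots\ x_d(T-2)]$, $Y_p=[y_d(0)\ \dots\ y_d(T-2)]$, $Y_f=[y_d(1)\ \dots\ y_d(T-1)]$, $X_{p,1}=[x_{d,1}(0)\ \dots\ x_{d,1}(T-2)]$, $X_{f,1}=[x_{d,1}(1)\ \dots\ x_{d,1}(T-1)]$. Here $\ker(M)$ denotes the null space of $M$. *)

theory Defs
  imports
    Complex_Main
    "Jordan_Normal_Form.Matrix_Kernel"
    "Jordan_Normal_Form.Gauss_Jordan_Elimination"
    "Jordan_Normal_Form.DL_Rank"
begin

text \<open>
  The matrices of Jordan_Normal_Form allow zero dimensions, so the degenerate cases such as
  \<open>n = p\<close>, \<open>m = 0\<close> and \<open>q = 0\<close> are included.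
\<close>

definition append_cols :: "'a :: zero mat \<Rightarrow> 'a mat \<Rightarrow> 'a mat" (infixr \<open>@\<^sub>c\<close> 65) where
  "A @\<^sub>c B = four_block_mat A B (0\<^sub>m 0 (dim_col A)) (0\<^sub>m 0 (dim_col B))"

text \<open>Total version of the partial library inverse; meaningful only for invertible arguments.\<close>

definition mat_inv :: "'a :: field mat \<Rightarrow> 'a mat" where
  "mat_inv A = the (mat_inverse A)"

lemma mat_inv:
  fixes A :: "'a :: field mat"
  assumes A: "A \<in> carrier_mat k k" and inv: "invertible_mat A"
  shows "mat_inv A \<in> carrier_mat k k" "A * mat_inv A = 1\<^sub>m k" "mat_inv A * A = 1\<^sub>m k"
proof -
  from inv obtain B where 1: "A * B = 1\<^sub>m (dim_row A)" and 2: "B * A = 1\<^sub>m (dim_row B)"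
    unfolding invertible_mat_def inverts_mat_def by blast
  have "dim_col B = k" using arg_cong[OF 1, of dim_col] A by simp
  moreover have "dim_row B = k" using arg_cong[OF 2, of dim_col] A by simp
  ultimately have B: "B \<in> carrier_mat k k" by blast
  have "A \<in> Units (ring_mat TYPE('a) k ())"
    unfolding Units_def using A B 1 2 by (auto simp: ring_mat_simps)
  then have "mat_inverse A \<noteq> None" using mat_inverse(1)[OF A, where b = "()"] by blast
  then have "mat_inverse A = Some (mat_inv A)" unfolding mat_inv_def by simp
  from mat_inverse(2)[OF A this]
  show "mat_inv A \<in> carrier_mat k k" "A * mat_inv A = 1\<^sub>m k" "mat_inv A * A = 1\<^sub>m k" by auto
qed

text \<open>
  \<open>data_mat r a b s\<close> has the columns \<open>s a, \<dots>, s (b - 1)\<close>, each with \<open>r\<close> entries.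
\<close>

definition data_mat :: "nat \<Rightarrow> nat \<Rightarrow> nat \<Rightarrow> (nat \<Rightarrow> 'a vec) \<Rightarrow> 'a mat" where
  "data_mat r a b s = mat_of_cols r (map s [a..<b])"

end

theory Submission
  imports Defs
begin

text \<open>
  The theorem is a statement about the unknown input alone. Multiplying a data matrix by a vector \<open>v\<close>
  superposes the recorded samples with the weights \<open>v\<close>, and the superposition obeys the system
  equations: if \<open>u\<close>, \<open>d\<close>, \<open>x\<close> are the superposed inputs and state, the superposed successor state is
  \<open>A x + B u + E d\<close>. A vector in the kernel of the stacked matrix has \<open>u = 0\<close>, its superposed state has
  vanishing first block and vanishing output, hence \<open>x = 0\<close> because \<open>C2\<close> is invertible, and what is
  left of the condition on \<open>Yf\<close> is \<open>C E d = (C1 E1 + C2 E2) d = 0\<close>. On such a vector \<open>Xf1\<close> takes the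
  value \<open>E1 d\<close>. The rank assumption makes every \<open>d\<close> occur together with \<open>u = 0\<close> and \<open>x = 0\<close>
  (\<open>full_row_rank_surj\<close>). Therefore the kernel inclusion says precisely that
  \<open>(C1 E1 + C2 E2) d = 0\<close> implies \<open>E1 d = 0\<close>.

  Over a field an inclusion of kernels is a factorization (\<open>mat_factor_iff_kernel\<close>), so this means that
  \<open>E1 = D (C1 E1 + C2 E2)\<close> for some \<open>D\<close>. After rearranging, this is the last of the four observer
  equations; the other three merely define the remaining observer matrices in terms of \<open>D\<close>.
\<close>

section \<open>Kernel inclusion and factorization\<close>

text \<open>
  Induction on \<open>k\<close>. On the common kernel of the first \<open>k\<close> functionals, \<open>g\<close> vanishes wherever \<open>f k\<close>
  does, hence is a multiple of \<open>f k\<close> there; after subtracting that multiple, \<open>g\<close> vanishes on the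
  whole common kernel and the induction hypothesis applies. For this reason \<open>g\<close> has to be arbitrary
  in the induction.
\<close>

lemma functional_combination:
  fixes f :: "nat \<Rightarrow> 'a :: field vec"
  assumes "\<And>i. i < k \<Longrightarrow> f i \<in> carrier_vec q" and "g \<in> carrier_vec q"
    and "\<And>d. d \<in> carrier_vec q \<Longrightarrow> (\<And>i. i < k \<Longrightarrow> f i \<bullet> d = 0) \<Longrightarrow> g \<bullet> d = 0"
  shows "\<exists>c. \<forall>d \<in> carrier_vec q. g \<bullet> d = (\<Sum>i<k. c i * (f i \<bullet> d))"
  using assms
proof (induction k arbitrary: g)
  case 0
  then show ?case by simp
next
  case (Suc k)
  have fc: "f i \<in> carrier_vec q" if "i \<le> k" for i using Suc.prems(1) that by simp
  note g = Suc.prems(2)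
  obtain a where a: "\<And>d. d \<in> carrier_vec q \<Longrightarrow> (\<And>i. i < k \<Longrightarrow> f i \<bullet> d = 0) \<Longrightarrow>
      g \<bullet> d = a * (f k \<bullet> d)"
  proof (cases "\<exists>w \<in> carrier_vec q. (\<forall>i<k. f i \<bullet> w = 0) \<and> f k \<bullet> w \<noteq> 0")
    case True
    then obtain w where w: "w \<in> carrier_vec q" "\<And>i. i < k \<Longrightarrow> f i \<bullet> w = 0" "f k \<bullet> w \<noteq> 0"
      by blast
    show thesis
    proof (rule that[of "(g \<bullet> w) / (f k \<bullet> w)"])
      fix d assume d: "d \<in> carrier_vec q" and fd: "\<And>i. i < k \<Longrightarrow> f i \<bullet> d = 0"
      \<comment> \<open>Subtracting a multiple of \<open>w\<close> moves \<open>d\<close> into the kernel of \<open>f k\<close> as well.\<close>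
      let ?b = "(f k \<bullet> d) / (f k \<bullet> w)"
      have lin: "h \<bullet> (d - ?b \<cdot>\<^sub>v w) = h \<bullet> d - ?b * (h \<bullet> w)" if "h \<in> carrier_vec q" for h
        using that d w(1) by (simp add: scalar_prod_minus_distrib[of _ q])
      have "f i \<bullet> (d - ?b \<cdot>\<^sub>v w) = 0" if "i < Suc k" for i
      proof (cases "i = k")
        case True
        then show ?thesis using lin[OF fc[of k]] w(3) by simp
      next
        case False
        then have "i < k" using that by simp
        then show ?thesis using lin[OF fc[of i]] w(2) fd by simp
      qed
      then have "g \<bullet> (d - ?b \<cdot>\<^sub>v w) = 0" using Suc.prems(3) d w(1) by simp
      then show "g \<bullet> d = (g \<bullet> w) / (f k \<bullet> w) * (f k \<bullet> d)" using lin[OF g] by simp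
    qed
  next
    case False
    show thesis
    proof (rule that[of 0])
      fix d assume d: "d \<in> carrier_vec q" and fd: "\<And>i. i < k \<Longrightarrow> f i \<bullet> d = 0"
      have "f i \<bullet> d = 0" if "i < Suc k" for i
        using that False d fd by (metis less_Suc_eq)
      then show "g \<bullet> d = 0 * (f k \<bullet> d)" using Suc.prems(3) d by simp
    qed
  qed
  let ?g = "g - a \<cdot>\<^sub>v f k"
  have g': "?g \<bullet> d = g \<bullet> d - a * (f k \<bullet> d)" if "d \<in> carrier_vec q" for d
    using that g fc[of k] by (simp add: minus_scalar_prod_distrib[of _ q])
  have "\<exists>c. \<forall>d \<in> carrier_vec q. ?g \<bullet> d = (\<Sum>i<k. c i * (f i \<bullet> d))"
    using fc g by (intro Suc.IH) (auto simp: g' a)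
  then obtain c where "\<forall>d \<in> carrier_vec q. ?g \<bullet> d = (\<Sum>i<k. c i * (f i \<bullet> d))" ..
  then have "\<forall>d \<in> carrier_vec q. g \<bullet> d = (\<Sum>i<Suc k. (c(k := a)) i * (f i \<bullet> d))"
    by (auto simp: g' algebra_simps)
  then show ?case by blast
qed

text \<open>
  The nontrivial direction applies \<open>functional_combination\<close> to the rows of the two matrices: the
  coefficients that express row \<open>i\<close> of \<open>N\<close> by the rows of \<open>M\<close> form row \<open>i\<close> of the factor.
\<close>

lemma mat_factor_iff_kernel:
  fixes M N :: "'a :: field mat"
  assumes M: "M \<in> carrier_mat r q" and N: "N \<in> carrier_mat s q"
  shows "(\<exists>D \<in> carrier_mat s r. N = D * M) \<longleftrightarrow>
    (\<forall>d \<in> carrier_vec q. M *\<^sub>v d = 0\<^sub>v r \<longrightarrow> N *\<^sub>v d = 0\<^sub>v s)" (is "?F \<longleftrightarrow> ?K")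
proof
  assume ?F
  then obtain D where D: "D \<in> carrier_mat s r" "N = D * M" by blast
  then show ?K using M by (auto simp: assoc_mult_mat_vec[of _ s r _ q])
next
  assume K: ?K
  have "\<exists>c. \<forall>d \<in> carrier_vec q. row N i \<bullet> d = (\<Sum>j<r. c j * (row M j \<bullet> d))" if i: "i < s" for i
  proof (rule functional_combination)
    fix d assume d: "d \<in> carrier_vec q" and z: "\<And>j. j < r \<Longrightarrow> row M j \<bullet> d = 0"
    have "M *\<^sub>v d = 0\<^sub>v r" using z M by (intro eq_vecI) auto
    then have "(N *\<^sub>v d) $ i = 0" using K d i by simp
    then show "row N i \<bullet> d = 0" using i N by simp
  qed (use M N i in auto)
  then obtain c where c: "\<And>i d. i < s \<Longrightarrow> d \<in> carrier_vec q \<Longrightarrow>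
      row N i \<bullet> d = (\<Sum>j<r. c i j * (row M j \<bullet> d))"
    by metis
  let ?D = "mat s r (\<lambda>(i, j). c i j)"
  have "N = ?D * M"
  proof (rule eq_matI)
    fix i l assume "i < dim_row (?D * M)" and "l < dim_col (?D * M)"
    then have i: "i < s" and l: "l < q" using M by auto
    \<comment> \<open>Unit vectors turn the identity of functionals into one of matrix entries.\<close>
    have "N $$ (i, l) = row N i \<bullet> unit_vec q l" using N i l by simp
    also have "\<dots> = (\<Sum>j<r. c i j * (row M j \<bullet> unit_vec q l))" using c[OF i] by simp
    also have "\<dots> = (\<Sum>j<r. c i j * M $$ (j, l))" using M l by simp
    also have "\<dots> = (?D * M) $$ (i, l)"
      using M i l by (auto simp: scalar_prod_def atLeast0LessThan intro!: sum.cong)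
    finally show "N $$ (i, l) = (?D * M) $$ (i, l)" .
  qed (use M N in auto)
  then show ?F by (intro bexI[of _ ?D]) auto
qed

text \<open>
  As many independent columns as the dimension of the space form a basis, so the columns span it.
\<close>

lemma full_row_rank_surj:
  fixes M :: "'a :: field mat"
  assumes M: "M \<in> carrier_mat r k" and rank: "vec_space.rank r M = r" and y: "y \<in> carrier_vec r"
  obtains v where "v \<in> carrier_vec k" "M *\<^sub>v v = y"
proof -
  interpret vec_space "TYPE('a)" r .
  have cols: "set (cols M) \<subseteq> carrier_vec r" using M cols_dim by blast
  obtain S where S: "maximal S (\<lambda>T. T \<subseteq> set (cols M) \<and> lin_indpt T)"
    using maximal_exists_superset[of "set (cols M)" "\<lambda>T. T \<subseteq> set (cols M) \<and> lin_indpt T" "{}"]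
    by (auto simp: lindep_span)
  then have sub: "S \<subseteq> set (cols M)" and li: "lin_indpt S" unfolding maximal_def by auto
  have card: "card S = r" using rank_card_indpt[OF M S] rank by simp
  have fin: "finite S" using sub finite_subset by blast
  have "basis S"
    using sub cols li card fin by (intro dim_li_is_basis) (auto simp: dim_is_n)
  then have "y \<in> span S" using y unfolding basis_def by simp
  then have "y \<in> col_space M" unfolding col_space_def using span_is_monotone[OF sub] by blast
  then show thesis using that M by (auto simp: col_space_eq[OF M])
qed

section \<open>Block matrices and vectors\<close>

lemma append_cols_mult_vec:
  fixes P Q :: "'a :: comm_semiring_1 mat"
  assumes P: "P \<in> carrier_mat r k1" and Q: "Q \<in> carrier_mat r k2"
    and x: "x \<in> carrier_vec k1" and y: "y \<in> carrier_vec k2"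
  shows "(P @\<^sub>c Q) *\<^sub>v (x @\<^sub>v y) = P *\<^sub>v x + Q *\<^sub>v y"
proof -
  have "(P @\<^sub>c Q) *\<^sub>v (x @\<^sub>v y)
      = (P *\<^sub>v x + Q *\<^sub>v y) @\<^sub>v (0\<^sub>m 0 k1 *\<^sub>v x + 0\<^sub>m 0 k2 *\<^sub>v y)"
    using four_block_mat_mult_vec[OF P Q zero_carrier_mat zero_carrier_mat x y] P Q
    by (simp add: append_cols_def)
  also have "\<dots> = P *\<^sub>v x + Q *\<^sub>v y" using P Q by (intro eq_vecI) auto
  finally show ?thesis .
qed

lemma append_cols_carrier:
  "P \<in> carrier_mat r k1 \<Longrightarrow> Q \<in> carrier_mat r k2 \<Longrightarrow> P @\<^sub>c Q \<in> carrier_mat r (k1 + k2)"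
  unfolding append_cols_def by auto

lemma append_rows_mult_vec_eq_0:
  fixes P Q :: "'a :: comm_semiring_1 mat"
  assumes P: "P \<in> carrier_mat r1 k" and Q: "Q \<in> carrier_mat r2 k" and v: "v \<in> carrier_vec k"
  shows "(P @\<^sub>r Q) *\<^sub>v v = 0\<^sub>v (r1 + r2) \<longleftrightarrow> P *\<^sub>v v = 0\<^sub>v r1 \<and> Q *\<^sub>v v = 0\<^sub>v r2"
proof -
  have "0\<^sub>v (r1 + r2) = 0\<^sub>v r1 @\<^sub>v (0\<^sub>v r2 :: 'a vec)" by (intro eq_vecI) auto
  then show ?thesis using mat_mult_append[OF P Q v] P v by (simp add: append_vec_eq[of _ r1])
qed

lemma vec_first_mult_append_rows:
  fixes P Q :: "'a :: comm_semiring_1 mat"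
  assumes "P \<in> carrier_mat r1 k" and "Q \<in> carrier_mat r2 k" and "v \<in> carrier_vec k"
  shows "vec_first ((P @\<^sub>r Q) *\<^sub>v v) r1 = P *\<^sub>v v"
  using assms by (auto simp: mat_mult_append[OF assms] vec_first_def)

section \<open>Superposition of recorded samples\<close>

lemma data_mat_carrier [simp]: "data_mat r a b s \<in> carrier_mat r (b - a)"
  unfolding data_mat_def by (simp add: mat_of_cols_def)

lemma data_mat_mult_vec_index:
  assumes "i < r" and "v \<in> carrier_vec (b - a)"
  shows "(data_mat r a b s *\<^sub>v v) $ i = (\<Sum>t<b - a. s (a + t) $ i * v $ t)"
  using assms unfolding data_mat_def
  by (auto simp: scalar_prod_def atLeast0LessThan mat_of_cols_def intro!: sum.cong)

lemma vec_first_data_mat: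
  assumes "k \<le> r" and v: "v \<in> carrier_vec (b - a)"
  shows "data_mat k a b (\<lambda>t. vec_first (s t) k) *\<^sub>v v = vec_first (data_mat r a b s *\<^sub>v v) k"
proof (rule eq_vecI)
  fix i assume "i < dim_vec (vec_first (data_mat r a b s *\<^sub>v v) k)"
  then have "i < k" "i < r" using \<open>k \<le> r\<close> by auto
  then show "(data_mat k a b (\<lambda>t. vec_first (s t) k) *\<^sub>v v) $ i
      = vec_first (data_mat r a b s *\<^sub>v v) k $ i"
    using v data_mat_mult_vec_index[of i k v b a "\<lambda>t. vec_first (s t) k"]
      data_mat_mult_vec_index[of i r v b a s]
    by (simp add: vec_first_def)
qed (simp add: data_mat_def)

lemma data_mat_mult:
  fixes M :: "'a :: comm_ring_1 mat"
  assumes M: "M \<in> carrier_mat k r" and s: "\<And>t. a \<le> t \<Longrightarrow> t < b \<Longrightarrow> s t \<in> carrier_vec r"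
    and v: "v \<in> carrier_vec (b - a)"
  shows "data_mat k a b (\<lambda>t. M *\<^sub>v s t) *\<^sub>v v = M *\<^sub>v (data_mat r a b s *\<^sub>v v)"
proof -
  have "data_mat k a b (\<lambda>t. M *\<^sub>v s t) = M * data_mat r a b s"
    using M s unfolding data_mat_def
    by (intro eq_matI) (auto simp: mat_of_cols_index intro!: arg_cong2[of _ _ _ _ "(\<bullet>)"] eq_vecI)
  then show ?thesis using M v by (simp add: assoc_mult_mat_vec[of _ k r _ "b - a"])
qed

lemma data_mat_cong:
  assumes "\<And>t. a \<le> t \<Longrightarrow> t < b \<Longrightarrow> s t = s' t"
  shows "data_mat r a b s = data_mat r a b s'"
proof -
  have "map s [a..<b] = map s' [a..<b]" using assms by simp
  then show ?thesis unfolding data_mat_def by presburger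
qed

lemma data_mat_add:
  fixes s s' :: "nat \<Rightarrow> 'a :: comm_ring_1 vec"
  assumes s: "\<And>t. a \<le> t \<Longrightarrow> t < b \<Longrightarrow> s t \<in> carrier_vec r"
    and s': "\<And>t. a \<le> t \<Longrightarrow> t < b \<Longrightarrow> s' t \<in> carrier_vec r"
    and v: "v \<in> carrier_vec (b - a)"
  shows "data_mat r a b (\<lambda>t. s t + s' t) *\<^sub>v v = data_mat r a b s *\<^sub>v v + data_mat r a b s' *\<^sub>v v"
proof (rule eq_vecI)
  have dims: "dim_vec (data_mat r a b w *\<^sub>v v) = r" for w :: "nat \<Rightarrow> 'a vec"
    by (simp add: data_mat_def)
  fix i assume "i < dim_vec (data_mat r a b s *\<^sub>v v + data_mat r a b s' *\<^sub>v v)"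
  then have i: "i < r" by (simp add: data_mat_def)
  have "(s (a + t) + s' (a + t)) $ i = s (a + t) $ i + s' (a + t) $ i" if "t < b - a" for t
  proof -
    have "a + t < b" using that by linarith
    then show ?thesis using i s'[of "a + t"] by simp
  qed
  then show "(data_mat r a b (\<lambda>t. s t + s' t) *\<^sub>v v) $ i
      = (data_mat r a b s *\<^sub>v v + data_mat r a b s' *\<^sub>v v) $ i"
    using i v dims by (simp add: data_mat_mult_vec_index algebra_simps sum.distrib del: index_mult_mat_vec)
qed (simp add: data_mat_def)

text \<open>
  Aligning the matrices of successors with those of predecessors makes the state equation an
  equation between columns.
\<close>

lemma data_mat_shift: "data_mat r 1 T s = data_mat r 0 (T - 1) (\<lambda>t. s (t + 1))"
  unfolding data_mat_def by (rule arg_cong[of _ _ "mat_of_cols r"], rule nth_equalityI) auto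

section \<open>Existence of an unknown input observer from data\<close>

theorem mainTheorem3:
  fixes n m q p T :: nat
    and A B E C A11 A12 A21 A22 B1 B2 E1 E2 C1 C2 :: "real mat"
    and ud dd xd yd :: "nat \<Rightarrow> real vec"
    and Up Dp Xp Yp Yf Xp1 Xf1 :: "real mat"
  assumes "p \<le> n"
    and "A11 \<in> carrier_mat (n - p) (n - p)" and "A12 \<in> carrier_mat (n - p) p"
    and "A21 \<in> carrier_mat p (n - p)" and "A22 \<in> carrier_mat p p"
    and "B1 \<in> carrier_mat (n - p) m" and "B2 \<in> carrier_mat p m"
    and "E1 \<in> carrier_mat (n - p) q" and "E2 \<in> carrier_mat p q"
    and "C1 \<in> carrier_mat p (n - p)" and "C2 \<in> carrier_mat p p"
    and "A = four_block_mat A11 A12 A21 A22"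
    and "B = B1 @\<^sub>r B2"
    and "E = E1 @\<^sub>r E2"
    and "C = C1 @\<^sub>c C2"
    and "invertible_mat C2"
    and "vec_space.rank n E = q"
    and "vec_space.rank p C = p"
    and "\<And>t. t < T - 1 \<Longrightarrow> ud t \<in> carrier_vec m"
    and "\<And>t. t < T - 1 \<Longrightarrow> dd t \<in> carrier_vec q"
    and "\<And>t. t < T \<Longrightarrow> xd t \<in> carrier_vec n"
    and "\<And>t. t < T \<Longrightarrow> yd t \<in> carrier_vec p"
    and "\<And>t. t < T - 1 \<Longrightarrow> xd (t + 1) = A *\<^sub>v xd t + B *\<^sub>v ud t + E *\<^sub>v dd t"
    and "\<And>t. t < T \<Longrightarrow> yd t = C *\<^sub>v xd t"
    and "Up = data_mat m 0 (T - 1) ud"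
    and "Dp = data_mat q 0 (T - 1) dd"
    and "Xp = data_mat n 0 (T - 1) xd"
    and "Yp = data_mat p 0 (T - 1) yd"
    and "Yf = data_mat p 1 T yd"
    and "Xp1 = data_mat (n - p) 0 (T - 1) (\<lambda>t. vec_first (xd t) (n - p))"
    and "Xf1 = data_mat (n - p) 1 T (\<lambda>t. vec_first (xd t) (n - p))"
    and "vec_space.rank (m + q + n) (Up @\<^sub>r Dp @\<^sub>r Xp) = m + q + n"
  shows "mat_kernel (Up @\<^sub>r Yp @\<^sub>r Yf @\<^sub>r Xp1) \<subseteq> mat_kernel Xf1 \<longleftrightarrow>
    (\<exists>A_UIO \<in> carrier_mat (n - p) (n - p). \<exists>Bu_UIO \<in> carrier_mat (n - p) m.
     \<exists>By_UIO \<in> carrier_mat (n - p) p. \<exists>D_UIO \<in> carrier_mat (n - p) p.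
      A_UIO = (1\<^sub>m (n - p) - D_UIO * C1) * (A11 - A12 * mat_inv C2 * C1)
                - D_UIO * C2 * (A21 - A22 * mat_inv C2 * C1) \<and>
      Bu_UIO = (1\<^sub>m (n - p) - D_UIO * C1) * B1 - D_UIO * C2 * B2 \<and>
      By_UIO = A_UIO * D_UIO + (1\<^sub>m (n - p) - D_UIO * C1) * A12 * mat_inv C2
                - D_UIO * C2 * A22 * mat_inv C2 \<and>
      0\<^sub>m (n - p) q = (1\<^sub>m (n - p) - D_UIO * C1) * E1 - D_UIO * C2 * E2)"
proof -
  note p = assms(1) and A_parts = assms(2-5) and B_parts = assms(6,7) and E_parts = assms(8,9)
    and C_parts = assms(10,11) and A = assms(12) and B = assms(13) and E = assms(14) and C = assms(15)
    and C2_inv = assms(16) and seq_dims = assms(19-22) and state = assms(23) and out = assms(24)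
    and data = assms(25-31) and rank = assms(32)
  let ?N = "T - 1"
  have n: "n - p + p = n" using p by simp
  have Ac: "A \<in> carrier_mat n n" unfolding A using A_parts n
    by (metis four_block_carrier_mat)
  have Bc: "B \<in> carrier_mat n m" unfolding B using B_parts n by (metis carrier_append_rows)
  have Ec: "E \<in> carrier_mat n q" unfolding E using E_parts n by (metis carrier_append_rows)
  have Cc: "C \<in> carrier_mat p n" unfolding C using C_parts n by (metis append_cols_carrier)
  have datac: "Up \<in> carrier_mat m ?N" "Dp \<in> carrier_mat q ?N" "Xp \<in> carrier_mat n ?N"
    "Yp \<in> carrier_mat p ?N" "Yf \<in> carrier_mat p ?N" "Xp1 \<in> carrier_mat (n - p) ?N"
    "Xf1 \<in> carrier_mat (n - p) ?N"
    unfolding data using data_mat_carrier[of _ 0 ?N] data_mat_carrier[of _ 1 T] by auto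
  have mult_0: "Q *\<^sub>v 0\<^sub>v k = 0\<^sub>v r" if "Q \<in> carrier_mat r k" for Q :: "real mat" and r k
    using that by auto
  let ?M = "C1 * E1 + C2 * E2"
  have Mc: "?M \<in> carrier_mat p q" using C_parts E_parts by simp
  have C_split: "C *\<^sub>v x = C1 *\<^sub>v vec_first x (n - p) + C2 *\<^sub>v vec_last x p"
    if "x \<in> carrier_vec n" for x
    using append_cols_mult_vec[OF C_parts, of "vec_first x (n - p)" "vec_last x p"] that n
    by (simp add: C)
  have CE: "C *\<^sub>v (E *\<^sub>v d) = ?M *\<^sub>v d" if d: "d \<in> carrier_vec q" for d
  proof -
    have "E *\<^sub>v d = E1 *\<^sub>v d @\<^sub>v E2 *\<^sub>v d" unfolding E by (rule mat_mult_append[OF E_parts d])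
    then have "C *\<^sub>v (E *\<^sub>v d) = C1 *\<^sub>v (E1 *\<^sub>v d) + C2 *\<^sub>v (E2 *\<^sub>v d)"
      unfolding C using append_cols_mult_vec[OF C_parts, of "E1 *\<^sub>v d" "E2 *\<^sub>v d"] E_parts d by simp
    also have "\<dots> = ?M *\<^sub>v d"
      using C_parts E_parts d
      by (simp add: add_mult_distrib_mat_vec[of _ p q] assoc_mult_mat_vec[of _ p "n - p" _ q]
          assoc_mult_mat_vec[of _ p p _ q])
    finally show ?thesis .
  qed
  have E_first: "vec_first (E *\<^sub>v d) (n - p) = E1 *\<^sub>v d" if "d \<in> carrier_vec q" for d
    unfolding E using E_parts that by (rule vec_first_mult_append_rows)
  \<comment> \<open>The output together with the first block determines the state, as \<open>C2\<close> is invertible.\<close>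
  have zero_state: "x = 0\<^sub>v n"
    if x: "x \<in> carrier_vec n" and x1: "vec_first x (n - p) = 0\<^sub>v (n - p)" and Cx: "C *\<^sub>v x = 0\<^sub>v p" for x
  proof -
    have x2: "vec_last x p \<in> carrier_vec p" by simp
    have "C2 *\<^sub>v vec_last x p = 0\<^sub>v p"
      using mult_0[OF C_parts(1)] C_split[OF x] C_parts x1 Cx x2 by simp
    then have "(mat_inv C2 * C2) *\<^sub>v vec_last x p = 0\<^sub>v p"
      using mat_inv(1)[OF C_parts(2) C2_inv] C_parts(2) x2
        mult_0[OF mat_inv(1)[OF C_parts(2) C2_inv]]
      by (simp add: assoc_mult_mat_vec[of _ p p _ p])
    then have "vec_last x p = 0\<^sub>v p" using mat_inv(3)[OF C_parts(2) C2_inv] x2 by simp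
    then have "x = 0\<^sub>v (n - p) @\<^sub>v 0\<^sub>v p"
      using vec_first_last_append[of x "n - p" p] x x1 n by simp
    then show ?thesis using n by (auto intro!: eq_vecI)
  qed

  \<comment> \<open>The superposed inputs and state, and the successor state that the dynamics assign to them.\<close>
  let ?u = "\<lambda>v. Up *\<^sub>v v" and ?d = "\<lambda>v. Dp *\<^sub>v v" and ?x = "\<lambda>v. Xp *\<^sub>v v"
  let ?xf = "\<lambda>v. A *\<^sub>v ?x v + B *\<^sub>v ?u v + E *\<^sub>v ?d v"
  have xf: "data_mat n 1 T xd *\<^sub>v v = ?xf v" if v: "v \<in> carrier_vec ?N" for v
  proof -
    have dims: "xd t \<in> carrier_vec n" "ud t \<in> carrier_vec m" "dd t \<in> carrier_vec q"
      if "t < ?N" for t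
      using seq_dims that by auto
    have "data_mat n 1 T xd = data_mat n 0 ?N (\<lambda>t. A *\<^sub>v xd t + B *\<^sub>v ud t + E *\<^sub>v dd t)"
      unfolding data_mat_shift by (rule data_mat_cong) (simp add: state[unfolded Suc_eq_plus1[symmetric]])
    then show ?thesis unfolding data using v Ac Bc Ec dims
      by (simp add: data_mat_add data_mat_mult[where r = n] data_mat_mult[where r = m]
          data_mat_mult[where r = q])
  qed
  have yp: "Yp *\<^sub>v v = C *\<^sub>v ?x v" if v: "v \<in> carrier_vec ?N" for v
  proof -
    have "Yp = data_mat p 0 ?N (\<lambda>t. C *\<^sub>v xd t)"
      unfolding data by (rule data_mat_cong) (simp add: out)
    then show ?thesis unfolding data using v Cc seq_dims by (simp add: data_mat_mult)
  qed
  have yf: "Yf *\<^sub>v v = C *\<^sub>v ?xf v" if v: "v \<in> carrier_vec ?N" for v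
  proof -
    have "Yf = data_mat p 1 T (\<lambda>t. C *\<^sub>v xd t)"
      unfolding data by (rule data_mat_cong) (simp add: out)
    then show ?thesis using v Cc seq_dims by (simp add: data_mat_mult xf[OF v, symmetric])
  qed
  have xp1: "Xp1 *\<^sub>v v = vec_first (?x v) (n - p)" if "v \<in> carrier_vec ?N" for v
    unfolding data using that by (simp add: vec_first_data_mat[of _ n])
  have xf1: "Xf1 *\<^sub>v v = vec_first (?xf v) (n - p)" if v: "v \<in> carrier_vec ?N" for v
    unfolding xf[OF v, symmetric] unfolding data using v by (simp add: vec_first_data_mat[of _ n])

  have xf_unknown: "?xf v = E *\<^sub>v ?d v"
    if v: "v \<in> carrier_vec ?N" and z: "?u v = 0\<^sub>v m" "?x v = 0\<^sub>v n" for v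
  proof -
    have "E *\<^sub>v ?d v \<in> carrier_vec n" using Ec datac v by auto
    then show ?thesis using z mult_0[OF Ac] mult_0[OF Bc] by simp
  qed
  have ker_iff: "v \<in> mat_kernel (Up @\<^sub>r Yp @\<^sub>r Yf @\<^sub>r Xp1) \<longleftrightarrow>
      ?u v = 0\<^sub>v m \<and> ?x v = 0\<^sub>v n \<and> ?M *\<^sub>v ?d v = 0\<^sub>v p" (is "_ \<longleftrightarrow> ?R")
    if v: "v \<in> carrier_vec ?N" for v
  proof -
    have vc: "?u v \<in> carrier_vec m" "?d v \<in> carrier_vec q" "?x v \<in> carrier_vec n"
      using datac v by auto
    have "Up @\<^sub>r Yp @\<^sub>r Yf @\<^sub>r Xp1 \<in> carrier_mat (m + (p + (p + (n - p)))) ?N"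
      using datac by (intro carrier_append_rows)
    then have "v \<in> mat_kernel (Up @\<^sub>r Yp @\<^sub>r Yf @\<^sub>r Xp1) \<longleftrightarrow>
        (Up @\<^sub>r Yp @\<^sub>r Yf @\<^sub>r Xp1) *\<^sub>v v = 0\<^sub>v (m + (p + (p + (n - p))))"
      using v by (simp add: mat_kernel)
    also have "\<dots> \<longleftrightarrow> ?u v = 0\<^sub>v m \<and> C *\<^sub>v ?x v = 0\<^sub>v p \<and> C *\<^sub>v ?xf v = 0\<^sub>v p \<and>
        vec_first (?x v) (n - p) = 0\<^sub>v (n - p)"
      using datac v
      by (subst append_rows_mult_vec_eq_0[where k = ?N] |
          simp add: yp[OF v] yf[OF v] xp1[OF v] carrier_append_rows)+
    also have "\<dots> \<longleftrightarrow> ?R"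
    proof -
      have z1: "vec_first (0\<^sub>v n :: real vec) (n - p) = 0\<^sub>v (n - p)"
        by (intro eq_vecI) (auto simp: vec_first_def)
      show ?thesis
      proof
        assume L: "?u v = 0\<^sub>v m \<and> C *\<^sub>v ?x v = 0\<^sub>v p \<and> C *\<^sub>v ?xf v = 0\<^sub>v p \<and>
          vec_first (?x v) (n - p) = 0\<^sub>v (n - p)"
        then have u: "?u v = 0\<^sub>v m" and x: "?x v = 0\<^sub>v n" using zero_state[OF vc(3)] by blast+
        have "?M *\<^sub>v ?d v = C *\<^sub>v ?xf v" unfolding xf_unknown[OF v u x] CE[OF vc(2)] ..
        then show ?R using u x L by metis
      next
        assume R: ?R
        then have u: "?u v = 0\<^sub>v m" and x: "?x v = 0\<^sub>v n" by blast+
        have "C *\<^sub>v ?xf v = 0\<^sub>v p" unfolding xf_unknown[OF v u x] CE[OF vc(2)] using R by blast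
        then show "?u v = 0\<^sub>v m \<and> C *\<^sub>v ?x v = 0\<^sub>v p \<and> C *\<^sub>v ?xf v = 0\<^sub>v p \<and>
            vec_first (?x v) (n - p) = 0\<^sub>v (n - p)"
          using u x z1 mult_0[OF Cc] by simp
      qed
    qed
    finally show ?thesis .
  qed
  have ker_f_iff: "v \<in> mat_kernel Xf1 \<longleftrightarrow> E1 *\<^sub>v ?d v = 0\<^sub>v (n - p)"
    if v: "v \<in> carrier_vec ?N" and z: "?u v = 0\<^sub>v m" "?x v = 0\<^sub>v n" for v
  proof -
    have d: "?d v \<in> carrier_vec q" using datac v by auto
    show ?thesis using v datac xf_unknown[OF v z] xf1[OF v] E_first[OF d] by (simp add: mat_kernel[of _ "n - p" ?N])
  qed

  have stackc: "Up @\<^sub>r Dp @\<^sub>r Xp \<in> carrier_mat (m + q + n) ?N"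
    using carrier_append_rows[OF datac(1) carrier_append_rows[OF datac(2,3)]] by (simp add: add.assoc)
  \<comment> \<open>Persistence of excitation: the unknown input can be prescribed while the rest is switched off.\<close>
  have excite: "\<exists>v \<in> carrier_vec ?N. ?u v = 0\<^sub>v m \<and> ?x v = 0\<^sub>v n \<and> ?d v = d"
    if d: "d \<in> carrier_vec q" for d
  proof -
    have "0\<^sub>v m @\<^sub>v d @\<^sub>v 0\<^sub>v n \<in> carrier_vec (m + q + n)"
      using d by (intro carrier_vecI) simp
    from full_row_rank_surj[OF stackc rank this]
    obtain v where v: "v \<in> carrier_vec ?N"
      and eq: "(Up @\<^sub>r Dp @\<^sub>r Xp) *\<^sub>v v = 0\<^sub>v m @\<^sub>v d @\<^sub>v 0\<^sub>v n" by blast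
    have "?u v @\<^sub>v ?d v @\<^sub>v ?x v = 0\<^sub>v m @\<^sub>v d @\<^sub>v 0\<^sub>v n"
      using eq mat_mult_append[OF datac(1) carrier_append_rows[OF datac(2,3)] v]
        mat_mult_append[OF datac(2,3) v] by simp
    then have "?u v = 0\<^sub>v m \<and> ?d v = d \<and> ?x v = 0\<^sub>v n"
      using datac v d append_vec_eq[of "?u v" m "0\<^sub>v m"] append_vec_eq[of "?d v" q d] by auto
    then show ?thesis using v by blast
  qed

  have "mat_kernel (Up @\<^sub>r Yp @\<^sub>r Yf @\<^sub>r Xp1) \<subseteq> mat_kernel Xf1 \<longleftrightarrow>
      (\<forall>d \<in> carrier_vec q. ?M *\<^sub>v d = 0\<^sub>v p \<longrightarrow> E1 *\<^sub>v d = 0\<^sub>v (n - p))"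
    (is "?K \<subseteq> _ \<longleftrightarrow> ?Q")
  proof
    assume incl: "?K \<subseteq> mat_kernel Xf1"
    show ?Q
    proof (intro ballI impI)
      fix d assume d: "d \<in> carrier_vec q" and Md: "?M *\<^sub>v d = 0\<^sub>v p"
      obtain v where v: "v \<in> carrier_vec ?N" "?u v = 0\<^sub>v m" "?x v = 0\<^sub>v n" "?d v = d"
        using excite[OF d] by blast
      then have "v \<in> mat_kernel Xf1" using ker_iff[OF v(1)] Md incl by auto
      then show "E1 *\<^sub>v d = 0\<^sub>v (n - p)" using ker_f_iff[OF v(1-3)] v(4) by simp
    qed
  next
    assume Q: ?Q
    show "?K \<subseteq> mat_kernel Xf1"
    proof
      fix v assume vK: "v \<in> ?K"
      moreover have "dim_col (Up @\<^sub>r Yp @\<^sub>r Yf @\<^sub>r Xp1) = ?N"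
        using datac(1) by (simp add: append_rows_def)
      ultimately have v: "v \<in> carrier_vec ?N" unfolding mat_kernel_def by simp
      moreover have "?d v \<in> carrier_vec q" using datac v by auto
      ultimately show "v \<in> mat_kernel Xf1" using ker_iff ker_f_iff vK Q by blast
    qed
  qed
  also have "\<dots> \<longleftrightarrow> (\<exists>D \<in> carrier_mat (n - p) p. E1 = D * ?M)"
    using mat_factor_iff_kernel[OF Mc E_parts(1)] by simp
  also have "\<dots> \<longleftrightarrow> (\<exists>D \<in> carrier_mat (n - p) p.
      0\<^sub>m (n - p) q = (1\<^sub>m (n - p) - D * C1) * E1 - D * C2 * E2)"
  proof (intro bex_cong refl)
    fix D :: "real mat" assume D: "D \<in> carrier_mat (n - p) p"
    have c: "D * (C1 * E1) \<in> carrier_mat (n - p) q" "D * (C2 * E2) \<in> carrier_mat (n - p) q"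
      using D C_parts E_parts by auto
    have "(1\<^sub>m (n - p) - D * C1) * E1 = E1 - D * (C1 * E1)"
      using D C_parts E_parts
      by (simp add: minus_mult_distrib_mat[of _ "n - p" "n - p"] assoc_mult_mat[of _ "n - p" p])
    moreover have "D * C2 * E2 = D * (C2 * E2)"
      using D C_parts E_parts by (simp add: assoc_mult_mat[of _ "n - p" p])
    moreover have "D * ?M = D * (C1 * E1) + D * (C2 * E2)"
      using D C_parts E_parts by (intro mult_add_distrib_mat) auto
    moreover have "E1 = X + Y \<longleftrightarrow> 0\<^sub>m (n - p) q = E1 - X - Y"
      if X: "X \<in> carrier_mat (n - p) q" and Y: "Y \<in> carrier_mat (n - p) q" for X Y
    proof -
      have "e = x + y \<longleftrightarrow> 0 = e - x - y" for e x y :: real by auto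
      then show ?thesis using E_parts(1) X Y by (auto simp: mat_eq_iff)
    qed
    ultimately show "E1 = D * ?M \<longleftrightarrow>
        0\<^sub>m (n - p) q = (1\<^sub>m (n - p) - D * C1) * E1 - D * C2 * E2"
      using c by simp
  qed
  also have "\<dots> \<longleftrightarrow> (\<exists>A_UIO \<in> carrier_mat (n - p) (n - p). \<exists>Bu_UIO \<in> carrier_mat (n - p) m.
     \<exists>By_UIO \<in> carrier_mat (n - p) p. \<exists>D_UIO \<in> carrier_mat (n - p) p.
      A_UIO = (1\<^sub>m (n - p) - D_UIO * C1) * (A11 - A12 * mat_inv C2 * C1)
                - D_UIO * C2 * (A21 - A22 * mat_inv C2 * C1) \<and>
      Bu_UIO = (1\<^sub>m (n - p) - D_UIO * C1) * B1 - D_UIO * C2 * B2 \<and>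
      By_UIO = A_UIO * D_UIO + (1\<^sub>m (n - p) - D_UIO * C1) * A12 * mat_inv C2
                - D_UIO * C2 * A22 * mat_inv C2 \<and>
      0\<^sub>m (n - p) q = (1\<^sub>m (n - p) - D_UIO * C1) * E1 - D_UIO * C2 * E2)" (is "?L \<longleftrightarrow> ?UIO")
  proof
    assume ?L
    then obtain D where D: "D \<in> carrier_mat (n - p) p"
      and D0: "0\<^sub>m (n - p) q = (1\<^sub>m (n - p) - D * C1) * E1 - D * C2 * E2" by blast
    let ?P = "1\<^sub>m (n - p) - D * C1"
    let ?A = "?P * (A11 - A12 * mat_inv C2 * C1) - D * C2 * (A21 - A22 * mat_inv C2 * C1)"
    have Ci: "mat_inv C2 \<in> carrier_mat p p" by (rule mat_inv(1)[OF C_parts(2) C2_inv])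
    have P: "?P \<in> carrier_mat (n - p) (n - p)" and DC: "D * C2 \<in> carrier_mat (n - p) p"
      using D C_parts by auto
    have "?A \<in> carrier_mat (n - p) (n - p)"
      by (intro minus_carrier_mat mult_carrier_mat[OF DC] mult_carrier_mat[OF _ C_parts(1)]
          mult_carrier_mat[OF A_parts(4) Ci])
    moreover have "?P * B1 - D * C2 * B2 \<in> carrier_mat (n - p) m"
      by (intro minus_carrier_mat mult_carrier_mat[OF DC] B_parts)
    moreover have "?A * D + ?P * A12 * mat_inv C2 - D * C2 * A22 * mat_inv C2
        \<in> carrier_mat (n - p) p"
      by (intro minus_carrier_mat mult_carrier_mat[OF _ Ci] mult_carrier_mat[OF DC] A_parts)
    ultimately show ?UIO using D D0 by blast
  next
    assume ?UIO
    then show ?L by blast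
  qed
  finally show ?thesis .
qed

end
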